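(* Let $C$ be a bounded convex subset of a Banach space $X$ and let $I$ be an infinite set. Let $(x_i)_{i\in I}\in C^I$. The following assertions are equivalent: (i) $(x_i)_{\mathcal U}$ is a strongly extreme point of $C_{\mathcal U}$ for every free ultrafilter $\mathcal U$ on $I$; (ii) $(x_i)_{\mathcal U}$ is an extreme point of $C_{\mathcal U}$ for every free ultrafilter $\mathcal U$ on $I$; (iii) for any $(y_i)_{i\in I},(z_i)_{i\in I}\in C^I$ such that $\left(\left\|x_i-\frac{y_i+z_i}{2}\right\|\right)_{i\in I}\in c_0(I)$, it follows that $(\|x_i-y_i\|)_{i\in I}\in c_0(I)$ and $(\|x_i-z_i\|)_{i\in I}\in c_0(I)$; (iv) for every countable subset $J\subseteq I$ and every free ultrafilter $\mathcal V$ on $J$, the element $(x_j)_{\mathcal V}$ given by the family $(x_j)_{j\in J}$ is an extreme point of $C_{\mathcal V}$.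
   Context: Banach spaces are real. A free ultrafilter is a non-principal ultrafilter. For a free ultrafilter $\mathcal U$ on an infinite set $I$, the ultrapower is $X_{\mathcal U}=\ell_\infty(I,X)/\{(x_i)_{i\in I}:\lim_{\mathcal U}\|x_i\|=0\}$; the class of $(x_i)_{i\in I}$ is written $(x_i)_{\mathcal U}$ and has norm $\lim_{\mathcal U}\|x_i\|$. For bounded $A\subset X$, $A_{\mathcal U}=\{(x_i)_{\mathcal U}: x_i\in A\ \forall i\in I\}$. The same notation is used for free ultrafilters $\mathcal V$ on an infinite set $J$. $c_0(I)$ is the set of bounded functions $f:I\to\mathbb R$ such that $\{i\in I:|f(i)|\geq\varepsilon\}$ is finite for every $\varepsilon>0$. For a bounded convex set $D$ in a Banach space, a point $x\in D$ is strongly extreme if for all sequences $(y_n),(z_n)$ in $D$ with $\|x-\frac{y_n+z_n}{2}\|\to0$ one has $\|y_n-z_n\|\to 0$. *)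

theory Defs
  imports "HOL-Analysis.Analysis"
begin

section \<open>Free ultrafilters on a set\<close>

text \<open>
  A filter on the set \<open>I\<close> is represented by a filter \<open>U\<close> on the ambient type with
  \<open>U \<le> principal I\<close>; its members are the sets \<open>A \<subseteq> I\<close> such that
  \<open>\<forall>\<^sub>F i in U. i \<in> A\<close>.
\<close>

definition ultrafilter_on :: "'i set \<Rightarrow> 'i filter \<Rightarrow> bool" where
  "ultrafilter_on I U \<longleftrightarrow>
     U \<le> principal I \<and> U \<noteq> bot \<and>
     (\<forall>P. (\<forall>\<^sub>F i in U. P i) \<or> (\<forall>\<^sub>F i in U. \<not> P i))"

definition free_ultrafilter_on :: "'i set \<Rightarrow> 'i filter \<Rightarrow> bool" where
  "free_ultrafilter_on I U \<longleftrightarrow>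
     ultrafilter_on I U \<and> (\<forall>a\<in>I. U \<noteq> principal {a})"

section \<open>Normed spaces with an explicit carrier\<close>

text \<open>
  The ultrapower depends on the ultrafilter and so is not a type. Its operations are
  therefore collected in a record.
\<close>

record 'v normed_carrier =
  vcarrier :: "'v set"
  vadd :: "'v \<Rightarrow> 'v \<Rightarrow> 'v"
  vscale :: "real \<Rightarrow> 'v \<Rightarrow> 'v"
  vnorm :: "'v \<Rightarrow> real"

definition vdiff :: "('v, 'm) normed_carrier_scheme \<Rightarrow> 'v \<Rightarrow> 'v \<Rightarrow> 'v" where
  "vdiff E a b = vadd E a (vscale E (- 1) b)"

text \<open>The following two definitions are meant for subsets \<open>D\<close> of \<open>vcarrier E\<close>; the first
  is the library's \<open>extreme_point_of\<close>, with the open segment written out.\<close>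

definition extreme_point_in ::
    "('v, 'm) normed_carrier_scheme \<Rightarrow> 'v set \<Rightarrow> 'v \<Rightarrow> bool" where
  "extreme_point_in E D a \<longleftrightarrow>
     a \<in> D \<and>
     (\<forall>b\<in>D. \<forall>c\<in>D. \<not> (b \<noteq> c \<and>
        (\<exists>t. 0 < t \<and> t < 1 \<and> a = vadd E (vscale E (1 - t) b) (vscale E t c))))"

definition strongly_extreme_point_in ::
    "('v, 'm) normed_carrier_scheme \<Rightarrow> 'v set \<Rightarrow> 'v \<Rightarrow> bool" where
  "strongly_extreme_point_in E D a \<longleftrightarrow>
     a \<in> D \<and>
     (\<forall>y z :: nat \<Rightarrow> 'v.
        (\<forall>n. y n \<in> D) \<longrightarrow> (\<forall>n. z n \<in> D) \<longrightarrow>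
        (\<lambda>n. vnorm E (vdiff E a (vscale E (1/2) (vadd E (y n) (z n))))) \<longlonglongrightarrow> 0 \<longrightarrow>
        (\<lambda>n. vnorm E (vdiff E (y n) (z n))) \<longlonglongrightarrow> 0)"

section \<open>Ultrapowers\<close>

text \<open>
  A family indexed by \<open>I\<close> is a function on the ambient type whose values outside \<open>I\<close> are
  irrelevant: for \<open>U \<le> principal I\<close>, families that agree on \<open>I\<close> have the same class.
\<close>

definition ell_infty :: "'i set \<Rightarrow> ('i \<Rightarrow> 'a::real_normed_vector) set" where
  "ell_infty I = {f. bounded (f ` I)}"

definition ultra_rel ::
    "'i set \<Rightarrow> 'i filter \<Rightarrow> ('i \<Rightarrow> 'a::real_normed_vector) rel" where
  "ultra_rel I U =
     {(f, g). f \<in> ell_infty I \<and> g \<in> ell_infty I \<and> ((\<lambda>i. norm (f i - g i)) \<longlongrightarrow> 0) U}"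

definition ultra_class ::
    "'i set \<Rightarrow> 'i filter \<Rightarrow> ('i \<Rightarrow> 'a::real_normed_vector) \<Rightarrow> ('i \<Rightarrow> 'a) set" where
  "ultra_class I U f = ultra_rel I U `` {f}"

text \<open>The type argument only selects the base space \<open>X\<close>. That the operations do not depend
  on representatives is proved in \<open>vadd_ultrapower\<close>, \<open>vscale_ultrapower\<close> and
  \<open>vnorm_ultrapower\<close> below.\<close>

definition ultrapower ::
    "'a::real_normed_vector itself \<Rightarrow> 'i set \<Rightarrow> 'i filter \<Rightarrow> ('i \<Rightarrow> 'a) set normed_carrier" where
  "ultrapower X I U =
     \<lparr> vcarrier = ell_infty I // ultra_rel I U,
       vadd = (\<lambda>A B. \<Union>f\<in>A. \<Union>g\<in>B. ultra_class I U (\<lambda>i. f i + g i)),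
       vscale = (\<lambda>c A. \<Union>f\<in>A. ultra_class I U (\<lambda>i. c *\<^sub>R f i)),
       vnorm = (\<lambda>A. THE r. \<forall>f\<in>A. ((\<lambda>i. norm (f i)) \<longlongrightarrow> r) U) \<rparr>"

definition ultra_set ::
    "'i set \<Rightarrow> 'i filter \<Rightarrow> 'a::real_normed_vector set \<Rightarrow> ('i \<Rightarrow> 'a) set set" where
  "ultra_set I U A = {ultra_class I U f | f. \<forall>i\<in>I. f i \<in> A}"

section \<open>Functions vanishing at infinity on a discrete set\<close>

definition c0 :: "'i set \<Rightarrow> ('i \<Rightarrow> real) set" where
  "c0 I = {f. bounded (f ` I) \<and> (\<forall>e>0. finite {i\<in>I. \<bar>f i\<bar> \<ge> e})}"

section \<open>Well-definedness of the ultrapower\<close>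

lemma ell_infty_add:
  assumes "f \<in> ell_infty I" "g \<in> ell_infty I"
  shows "(\<lambda>i. f i + g i) \<in> ell_infty I"
  using assms unfolding ell_infty_def by (simp add: bounded_plus_comp)

lemma ell_infty_scale:
  assumes "f \<in> ell_infty I"
  shows "(\<lambda>i. c *\<^sub>R f i) \<in> ell_infty I"
  using bounded_scaling[of "f ` I" c] assms unfolding ell_infty_def by (simp add: image_image)

lemma equiv_ultra_rel: "equiv (ell_infty I) (ultra_rel I U)"
proof (rule equivI)
  show "ultra_rel I U \<subseteq> ell_infty I \<times> ell_infty I"
    by (auto simp: ultra_rel_def)
  show "refl_on (ell_infty I) (ultra_rel I U)"
    by (auto simp: refl_on_def ultra_rel_def)
  show "sym (ultra_rel I U)"
    by (auto simp: sym_def ultra_rel_def norm_minus_commute)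
  show "trans (ultra_rel I U)"
  proof (rule transI)
    fix f g h assume "(f, g) \<in> ultra_rel I U" "(g, h) \<in> ultra_rel I U"
    then have fh: "f \<in> ell_infty I" "h \<in> ell_infty I"
      and "((\<lambda>i. f i - g i) \<longlongrightarrow> 0) U" "((\<lambda>i. g i - h i) \<longlongrightarrow> 0) U"
      by (auto simp: ultra_rel_def tendsto_norm_zero_iff)
    then have "((\<lambda>i. f i - h i) \<longlongrightarrow> 0) U"
      using tendsto_add by fastforce
    with fh show "(f, h) \<in> ultra_rel I U"
      by (auto simp: ultra_rel_def tendsto_norm_zero_iff)
  qed
qed

lemma ultra_class_eq_iff:
  assumes "f \<in> ell_infty I" "g \<in> ell_infty I"
  shows "ultra_class I U f = ultra_class I U g \<longleftrightarrow> ((\<lambda>i. norm (f i - g i)) \<longlongrightarrow> 0) U"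
  unfolding ultra_class_def eq_equiv_class_iff[OF equiv_ultra_rel assms]
  using assms by (simp add: ultra_rel_def)

lemma ultra_class_cong:
  assumes "U \<le> principal I" "\<And>i. i \<in> I \<Longrightarrow> f i = g i"
  shows "ultra_class I U f = ultra_class I U g"
proof (cases "f \<in> ell_infty I")
  case True
  then have g: "g \<in> ell_infty I"
    using assms(2) by (simp add: ell_infty_def cong: image_cong)
  have "\<forall>\<^sub>F i in U. norm (f i - g i) = 0"
    using assms by (auto intro: filter_leD simp: eventually_principal)
  then have "((\<lambda>i. norm (f i - g i)) \<longlongrightarrow> 0) U"
    by (rule tendsto_eventually)
  then show ?thesis
    by (simp add: ultra_class_eq_iff[OF True g])
next
  case False
  then have "g \<notin> ell_infty I"
    using assms(2) by (simp add: ell_infty_def cong: image_cong)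
  with False show ?thesis
    by (auto simp: ultra_class_def ultra_rel_def)
qed

lemma self_in_ultra_class: "f \<in> ell_infty I \<Longrightarrow> f \<in> ultra_class I U f"
  by (simp add: ultra_class_def ultra_rel_def)

lemma vadd_ultrapower:
  assumes "f \<in> ell_infty I" "g \<in> ell_infty I"
  shows "vadd (ultrapower X I U) (ultra_class I U f) (ultra_class I U g) =
         ultra_class I U (\<lambda>i. f i + g i)"
proof -
  have "ultra_class I U (\<lambda>i. f' i + g' i) = ultra_class I U (\<lambda>i. f i + g i)"
    if "f' \<in> ultra_class I U f" "g' \<in> ultra_class I U g" for f' g'
  proof -
    from that have m: "f' \<in> ell_infty I" "g' \<in> ell_infty I"
      and "((\<lambda>i. f i - f' i) \<longlongrightarrow> 0) U" "((\<lambda>i. g i - g' i) \<longlongrightarrow> 0) U"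
      by (auto simp: ultra_class_def ultra_rel_def tendsto_norm_zero_iff)
    then have "((\<lambda>i. (f i - f' i) + (g i - g' i)) \<longlongrightarrow> 0 + 0) U"
      by (intro tendsto_add)
    then have "((\<lambda>i. (f i + g i) - (f' i + g' i)) \<longlongrightarrow> 0) U"
      by (simp add: algebra_simps)
    then show ?thesis
      using ultra_class_eq_iff[OF ell_infty_add[OF assms] ell_infty_add[OF m]]
      by (metis tendsto_norm_zero_iff)
  qed
  then show ?thesis
    unfolding ultrapower_def normed_carrier.simps
    by (intro UN_constant_eq[OF self_in_ultra_class] ballI assms)
qed

lemma vscale_ultrapower:
  assumes "f \<in> ell_infty I"
  shows "vscale (ultrapower X I U) c (ultra_class I U f) = ultra_class I U (\<lambda>i. c *\<^sub>R f i)"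
proof -
  have "ultra_class I U (\<lambda>i. c *\<^sub>R f' i) = ultra_class I U (\<lambda>i. c *\<^sub>R f i)"
    if "f' \<in> ultra_class I U f" for f'
  proof -
    from that have m: "f' \<in> ell_infty I" and "((\<lambda>i. f i - f' i) \<longlongrightarrow> 0) U"
      by (auto simp: ultra_class_def ultra_rel_def tendsto_norm_zero_iff)
    then have "((\<lambda>i. c *\<^sub>R (f i - f' i)) \<longlongrightarrow> c *\<^sub>R 0) U"
      by (intro tendsto_scaleR tendsto_const)
    then have "((\<lambda>i. c *\<^sub>R f i - c *\<^sub>R f' i) \<longlongrightarrow> 0) U"
      by (simp add: algebra_simps)
    then show ?thesis
      using ultra_class_eq_iff[OF ell_infty_scale[OF assms] ell_infty_scale[OF m]]
      by (metis tendsto_norm_zero_iff)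
  qed
  then show ?thesis
    unfolding ultrapower_def normed_carrier.simps
    by (intro UN_constant_eq[OF self_in_ultra_class] ballI assms)
qed

lemma ultrafilter_on_convergent:
  fixes h :: "'i \<Rightarrow> real"
  assumes U: "ultrafilter_on I U" and h: "bounded (h ` I)"
  shows "\<exists>r. (h \<longlongrightarrow> r) U"
proof -
  let ?K = "closure (h ` I)"
  have "compact ?K"
    using h by (simp add: compact_closure)
  moreover have "filtermap h U \<noteq> bot"
    using U by (simp add: ultrafilter_on_def filtermap_bot_iff)
  moreover have "\<forall>\<^sub>F y in filtermap h U. y \<in> ?K"
  proof -
    have "\<forall>\<^sub>F i in principal I. h i \<in> ?K"
      unfolding eventually_principal using closure_subset[of "h ` I"] by blast
    with U show ?thesis
      unfolding ultrafilter_on_def eventually_filtermap using filter_leD by metis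
  qed
  ultimately obtain r where r: "inf (nhds r) (filtermap h U) \<noteq> bot"
    unfolding compact_filter by blast
  have "\<forall>\<^sub>F i in U. h i \<in> S" if S: "open S" "r \<in> S" for S
  proof (rule ccontr)
    assume "\<not> ?thesis"
    with U have "\<forall>\<^sub>F y in filtermap h U. y \<notin> S"
      by (auto simp: ultrafilter_on_def eventually_filtermap)
    moreover have "\<forall>\<^sub>F y in nhds r. y \<in> S"
      using S by (rule eventually_nhds_in_open)
    ultimately have "\<forall>\<^sub>F y in inf (nhds r) (filtermap h U). False"
      unfolding eventually_inf by blast
    with r show False
      by (simp add: trivial_limit_def)
  qed
  then show ?thesis
    by (auto simp: tendsto_def)
qed

lemma vnorm_ultrapower:
  assumes U: "ultrafilter_on I U" and f: "f \<in> ell_infty I"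
  shows "((\<lambda>i. norm (f i)) \<longlongrightarrow> vnorm (ultrapower X I U) (ultra_class I U f)) U"
proof -
  have ne: "U \<noteq> bot"
    using U by (simp add: ultrafilter_on_def)
  have "bounded ((\<lambda>i. norm (f i)) ` I)"
    using f by (simp add: ell_infty_def bounded_norm_comp)
  then obtain r where r: "((\<lambda>i. norm (f i)) \<longlongrightarrow> r) U"
    using ultrafilter_on_convergent[OF U] by blast
  have lim: "((\<lambda>i. norm (g i)) \<longlongrightarrow> r) U" if "g \<in> ultra_class I U f" for g
  proof -
    from that have "((\<lambda>i. norm (f i - g i)) \<longlongrightarrow> 0) U"
      by (simp add: ultra_class_def ultra_rel_def)
    then have "((\<lambda>i. norm (f i) - norm (g i)) \<longlongrightarrow> 0) U"
      by (rule Lim_null_comparison[rotated]) (simp add: norm_triangle_ineq3)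
    from tendsto_diff[OF r this] show ?thesis
      by simp
  qed
  have "vnorm (ultrapower X I U) (ultra_class I U f) = r"
    unfolding ultrapower_def
    unfolding normed_carrier.simps
  proof (rule the_equality)
    show "\<forall>g\<in>ultra_class I U f. ((\<lambda>i. norm (g i)) \<longlongrightarrow> r) U"
      using lim by blast
  next
    fix r' assume "\<forall>g\<in>ultra_class I U f. ((\<lambda>i. norm (g i)) \<longlongrightarrow> r') U"
    with self_in_ultra_class[OF f] have "((\<lambda>i. norm (f i)) \<longlongrightarrow> r') U"
      by blast
    with r show "r' = r"
      using tendsto_unique[OF ne] by blast
  qed
  with r show ?thesis
    by simp
qed

lemma ultra_set_subset_ultrapower:
  assumes "bounded A"
  shows "ultra_set I U A \<subseteq> vcarrier (ultrapower X I U)"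
proof -
  have "f \<in> ell_infty I" if "\<forall>i\<in>I. f i \<in> A" for f
  proof -
    have "f ` I \<subseteq> A"
      using that by blast
    from bounded_subset[OF assms this] show ?thesis
      by (simp add: ell_infty_def)
  qed
  then have "ultra_class I U f \<in> ell_infty I // ultra_rel I U" if "\<forall>i\<in>I. f i \<in> A" for f
    unfolding ultra_class_def using that by (intro quotientI) blast
  then show ?thesis
    unfolding ultra_set_def ultrapower_def normed_carrier.simps by blast
qed

end

(* All four assertions are compared with a quantitative condition: for every eps > 0 there
   is delta > 0 such that, for all but finitely many i, any two points of C whose midpoint is
   delta-close to x_i are eps-close to each other. This gives (iii) at once, and also (i), as
   a free ultrafilter ignores finite sets; moreover it passes to subsets of I. If it fails
   for some eps, pick distinct indices i_n violating it for delta = 1/(n+1), and let y, z be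
   the corresponding families of points (equal to x elsewhere). They refute (iii), and on any
   free ultrafilter containing the countable set of all i_n their classes are distinct points
   with midpoint (x_i), which refutes (ii) and (iv). *)
theory Submission
  imports Defs
begin

section \<open>Free ultrafilters\<close>

text \<open>With this filter, freeness becomes an inequality between filters and membership in
  \<open>c0 I\<close> becomes boundedness plus convergence to 0, so both can be combined through
  \<open>tendsto_mono\<close>.\<close>

abbreviation cofinite_on :: "'i set \<Rightarrow> 'i filter" where
  "cofinite_on I \<equiv> inf cofinite (principal I)"

lemma eventually_cofinite_on: "eventually P (cofinite_on I) \<longleftrightarrow> finite {i\<in>I. \<not> P i}"
proof -
  have "{i. \<not> (i \<in> I \<longrightarrow> P i)} = {i\<in>I. \<not> P i}"
    by blast
  then show ?thesis
    by (simp add: eventually_inf_principal eventually_cofinite)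
qed

lemma cofinite_on_eq_bot_iff: "cofinite_on I = bot \<longleftrightarrow> finite I"
  by (simp add: trivial_limit_def eventually_cofinite_on)

lemma cofinite_on_mono: "J \<subseteq> I \<Longrightarrow> cofinite_on J \<le> cofinite_on I"
  by (intro inf_mono order_refl) simp

text \<open>A proper filter containing a singleton is the principal filter of that point. A free
  ultrafilter therefore contains the complement of every point of \<open>I\<close>, hence of every
  finite subset of \<open>I\<close>.\<close>

lemma free_ultrafilter_on_iff:
  "free_ultrafilter_on I U \<longleftrightarrow> ultrafilter_on I U \<and> U \<le> cofinite_on I"
proof
  assume free: "free_ultrafilter_on I U"
  then have U: "ultrafilter_on I U"
    by (simp add: free_ultrafilter_on_def)
  then have UI: "U \<le> principal I" and ne: "U \<noteq> bot"
    by (auto simp: ultrafilter_on_def)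
  have neq: "\<forall>\<^sub>F i in U. i \<noteq> a" if "a \<in> I" for a
  proof (rule ccontr)
    assume "\<not> ?thesis"
    with U have ev: "\<forall>\<^sub>F i in U. i = a"
      unfolding ultrafilter_on_def by fastforce
    \<comment> \<open>On the member {a} of \<open>U\<close> the event \<open>P\<close> amounts to
      the constant \<open>P a\<close>, and a constant event of a proper filter is true.\<close>
    have "P a" if "eventually P U" for P
    proof -
      from that ev have "\<forall>\<^sub>F i in U. P a"
        by eventually_elim simp
      with ne show "P a"
        by (simp add: eventually_const)
    qed
    with ev have "U = principal {a}"
      by (auto simp: filter_eq_iff eventually_principal elim: eventually_mono)
    with free that show False
      unfolding free_ultrafilter_on_def by blast
  qed
  have "eventually P U" if "eventually P (cofinite_on I)" for P
  proof -
    have "finite {i\<in>I. \<not> P i}"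
      using that by (simp add: eventually_cofinite_on)
    then have "\<forall>\<^sub>F i in U. \<forall>a\<in>{i\<in>I. \<not> P i}. i \<noteq> a"
      by (rule eventually_ball_finite) (simp add: neq)
    moreover have "\<forall>\<^sub>F i in U. i \<in> I"
      using UI by (simp add: le_principal)
    ultimately show ?thesis
      by eventually_elim blast
  qed
  with U show "ultrafilter_on I U \<and> U \<le> cofinite_on I"
    by (intro conjI filter_leI)
next
  assume *: "ultrafilter_on I U \<and> U \<le> cofinite_on I"
  have "U \<noteq> principal {a}" for a
  proof
    assume a: "U = principal {a}"
    have "\<forall>\<^sub>F i in cofinite_on I. i \<noteq> a"
      by (simp add: eventually_cofinite_on)
    with * have "\<forall>\<^sub>F i in U. i \<noteq> a"
      using filter_leD by blast
    with a show False
      by (simp add: eventually_principal)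
  qed
  with * show "free_ultrafilter_on I U"
    by (simp add: free_ultrafilter_on_def)
qed

text \<open>Finer filters are smaller, so Zorn's lemma is applied to the reversed order. A minimal
  proper filter decides every \<open>P\<close>, since otherwise restricting it to \<open>P\<close>
  would give a strictly finer proper filter.\<close>

lemma ultrafilter_below:
  fixes F :: "'i filter"
  assumes "F \<noteq> bot"
  obtains U where "U \<le> F" "U \<noteq> bot" "\<And>P. eventually P U \<or> (\<forall>\<^sub>F i in U. \<not> P i)"
proof -
  let ?A = "{G. G \<le> F \<and> G \<noteq> bot}"
  have "\<exists>m\<in>?A. \<forall>a\<in>?A. m \<ge> a \<longrightarrow> a = m"
  proof (rule predicate_Zorn)
    show "partial_order_on ?A (relation_of (\<ge>) ?A)"
      by (rule partial_order_on_relation_ofI) auto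
  next
    fix \<C> assume ch: "\<C> \<in> Chains (relation_of (\<ge>) ?A)"
    then have sub: "\<C> \<subseteq> ?A" and cmp: "\<And>G H. G \<in> \<C> \<Longrightarrow> H \<in> \<C> \<Longrightarrow> G \<le> H \<or> H \<le> G"
      by (auto simp: Chains_def relation_of_def)
    show "\<exists>u\<in>?A. \<forall>a\<in>\<C>. a \<ge> u"
    proof (cases "\<C> = {}")
      case True
      with assms show ?thesis by auto
    next
      case False
      \<comment> \<open>A chain is directed downwards, so an event of its infimum is already an
        event of some member; the false event is an event of none.\<close>
      have "\<exists>x\<in>\<C>. x \<le> inf G H" if "G \<in> \<C>" "H \<in> \<C>" for G H
        using cmp[OF that] that by (metis inf.absorb1 inf.absorb2 order_refl)
      then have "eventually P (Inf \<C>) \<longleftrightarrow> (\<exists>G\<in>\<C>. eventually P G)" for P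
        using eventually_Inf_base[OF False] by blast
      with sub have "Inf \<C> \<noteq> bot"
        by (auto simp: trivial_limit_def)
      moreover have "Inf \<C> \<le> F"
        using False sub by (blast intro: Inf_lower2)
      ultimately show ?thesis
        by (auto intro!: bexI[of _ "Inf \<C>"] Inf_lower)
    qed
  qed
  then obtain U where U: "U \<le> F" "U \<noteq> bot"
    and min: "\<And>G. G \<le> F \<Longrightarrow> G \<noteq> bot \<Longrightarrow> G \<le> U \<Longrightarrow> G = U"
    by blast
  have "eventually P U" if nP: "\<not> (\<forall>\<^sub>F i in U. \<not> P i)" for P
  proof -
    let ?G = "inf U (principal {i. P i})"
    have "?G \<noteq> bot"
      using nP by (simp add: trivial_limit_def eventually_inf_principal)
    moreover have "?G \<le> F"
      using U(1) by (rule le_infI1)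
    ultimately have "?G = U"
      by (intro min) simp_all
    moreover have "eventually P ?G"
      by (simp add: eventually_inf_principal)
    ultimately show ?thesis
      by simp
  qed
  with that[OF U] show thesis
    by blast
qed

lemma free_ultrafilter_on_exists:
  assumes "infinite J"
  obtains U where "free_ultrafilter_on J U"
proof -
  have "cofinite_on J \<noteq> bot"
    using assms by (simp add: cofinite_on_eq_bot_iff)
  then obtain U where "U \<le> cofinite_on J" "U \<noteq> bot" "\<And>P. eventually P U \<or> (\<forall>\<^sub>F i in U. \<not> P i)"
    by (rule ultrafilter_below) blast
  then have "free_ultrafilter_on J U"
    by (simp add: free_ultrafilter_on_iff ultrafilter_on_def)
  with that show thesis .
qed

text \<open>Filters live on the ambient type, so the extension from \<open>J\<close> to
  \<open>I\<close> is the same object \<open>U\<close>.\<close>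

lemma free_ultrafilter_on_superset:
  assumes "free_ultrafilter_on J U" "J \<subseteq> I"
  shows "free_ultrafilter_on I U"
proof -
  from assms(1) have U: "ultrafilter_on J U" "U \<le> cofinite_on J"
    unfolding free_ultrafilter_on_iff by blast+
  have "U \<le> cofinite_on I"
    using U(2) cofinite_on_mono[OF assms(2)] by (rule order_trans)
  with U(1) show ?thesis
    by (simp add: free_ultrafilter_on_iff ultrafilter_on_def)
qed

lemma c0_iff: "f \<in> c0 I \<longleftrightarrow> bounded (f ` I) \<and> (f \<longlongrightarrow> 0) (cofinite_on I)"
  by (simp add: c0_def tendsto_iff eventually_cofinite_on not_less)

section \<open>Points of the ultrapower\<close>

lemma ell_infty_family:
  assumes "bounded C" "\<forall>i\<in>I. f i \<in> C"
  shows "f \<in> ell_infty I"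
  using assms bounded_subset[of C "f ` I"] by (auto simp: ell_infty_def)

lemma ell_infty_diff:
  assumes "f \<in> ell_infty I" "g \<in> ell_infty I"
  shows "(\<lambda>i. f i - g i) \<in> ell_infty I"
  using assms unfolding ell_infty_def by (simp add: bounded_minus_comp)

lemma vdiff_ultrapower:
  assumes "f \<in> ell_infty I" "g \<in> ell_infty I"
  shows "vdiff (ultrapower X I U) (ultra_class I U f) (ultra_class I U g) =
         ultra_class I U (\<lambda>i. f i - g i)"
  unfolding vdiff_def vscale_ultrapower[OF assms(2)]
  using vadd_ultrapower[OF assms(1) ell_infty_scale[OF assms(2)], of X U "- 1"] by simp

lemma ultra_convex_combination:
  assumes "f \<in> ell_infty I" "g \<in> ell_infty I"
  shows "vadd (ultrapower X I U) (vscale (ultrapower X I U) s (ultra_class I U f))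
           (vscale (ultrapower X I U) t (ultra_class I U g)) =
         ultra_class I U (\<lambda>i. s *\<^sub>R f i + t *\<^sub>R g i)"
  by (simp add: assms vscale_ultrapower vadd_ultrapower ell_infty_scale)

text \<open>Otherwise the classes of \<open>y\<close> and \<open>z\<close> would be distinct points
  of \<open>ultra_set I U C\<close> whose midpoint is the class of \<open>x\<close>.\<close>

lemma extreme_point_in_tendsto:
  assumes "bounded C" "\<forall>i\<in>I. x i \<in> C" "\<forall>i\<in>I. y i \<in> C" "\<forall>i\<in>I. z i \<in> C"
    and lim: "((\<lambda>i. norm (x i - (1/2) *\<^sub>R (y i + z i))) \<longlongrightarrow> 0) U"
    and ext: "extreme_point_in (ultrapower X I U) (ultra_set I U C) (ultra_class I U x)"
  shows "((\<lambda>i. norm (y i - z i)) \<longlongrightarrow> 0) U"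
proof (rule ccontr)
  note ell = assms(2-4)[THEN ell_infty_family[OF \<open>bounded C\<close>]]
  assume "\<not> ?thesis"
  then have "ultra_class I U y \<noteq> ultra_class I U z"
    by (simp add: ultra_class_eq_iff ell)
  \<comment> \<open>The coefficient is kept as \<open>1 - 1/2\<close> to match the pattern
    \<open>1 - t\<close> of \<open>extreme_point_in_def\<close> at \<open>t = 1/2\<close>.\<close>
  moreover have "ultra_class I U x =
      vadd (ultrapower X I U) (vscale (ultrapower X I U) (1 - 1/2) (ultra_class I U y))
        (vscale (ultrapower X I U) (1/2) (ultra_class I U z))"
    using lim by (subst ultra_convex_combination)
      (simp_all add: ell ultra_class_eq_iff ell_infty_add ell_infty_scale scaleR_add_right)
  moreover have "ultra_class I U y \<in> ultra_set I U C" "ultra_class I U z \<in> ultra_set I U C"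
    using assms(3,4) by (auto simp: ultra_set_def)
  moreover have "(0::real) < 1/2" "(1/2::real) < 1"
    by simp_all
  ultimately show False
    using ext unfolding extreme_point_in_def by blast
qed

text \<open>Strong extremality concerns midpoints, extremality any interior point of a segment.
  Convexity of \<open>C\<close> bridges the gap by supplying, inside a given segment through the
  class of \<open>x\<close>, one that is centred there.\<close>

lemma strongly_extreme_imp_extreme:
  assumes "bounded C" "convex C" "\<forall>i\<in>I. x i \<in> C" and U: "ultrafilter_on I U"
    and str: "strongly_extreme_point_in (ultrapower X I U) (ultra_set I U C) (ultra_class I U x)"
  shows "extreme_point_in (ultrapower X I U) (ultra_set I U C) (ultra_class I U x)"
  unfolding extreme_point_in_def
proof (intro conjI ballI notI)
  let ?E = "ultrapower X I U"
  show "ultra_class I U x \<in> ultra_set I U C"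
    using assms(3) by (auto simp: ultra_set_def)
  fix b c assume "b \<in> ultra_set I U C" "c \<in> ultra_set I U C"
  then obtain f g where f: "b = ultra_class I U f" "\<forall>i\<in>I. f i \<in> C"
    and g: "c = ultra_class I U g" "\<forall>i\<in>I. g i \<in> C"
    by (auto simp: ultra_set_def)
  note ell = assms(3)[THEN ell_infty_family[OF \<open>bounded C\<close>]]
    f(2)[THEN ell_infty_family[OF \<open>bounded C\<close>]] g(2)[THEN ell_infty_family[OF \<open>bounded C\<close>]]
  assume "b \<noteq> c \<and> (\<exists>t. 0 < t \<and> t < 1 \<and>
    ultra_class I U x = vadd ?E (vscale ?E (1 - t) b) (vscale ?E t c))"
  then obtain t where "b \<noteq> c" and t: "0 < t" "t < 1"
    and eq: "ultra_class I U x = vadd ?E (vscale ?E (1 - t) b) (vscale ?E t c)"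
    by blast
  \<comment> \<open>The largest radius that keeps both \<open>t - ?s\<close> and
    \<open>t + ?s\<close> in the unit interval.\<close>
  let ?s = "min t (1 - t)"
  let ?comb = "\<lambda>r i. (1 - r) *\<^sub>R f i + r *\<^sub>R g i"
  \<comment> \<open>The segment from \<open>b\<close> to \<open>c\<close> contains a nondegenerate segment with midpoint \<open>x\<close>.\<close>
  let ?y = "?comb (t - ?s)" and ?z = "?comb (t + ?s)"
  have yC: "\<forall>i\<in>I. ?y i \<in> C" and zC: "\<forall>i\<in>I. ?z i \<in> C"
    using t f(2) g(2) by (auto intro!: convexD_alt[OF \<open>convex C\<close>])
  note elly = yC[THEN ell_infty_family[OF \<open>bounded C\<close>]]
    and ellz = zC[THEN ell_infty_family[OF \<open>bounded C\<close>]]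
  have mid: "(1/2) *\<^sub>R (?y i + ?z i) = ?comb t i" for i
  proof -
    have "?y i + ?z i = (2 * (1 - t)) *\<^sub>R f i + (2 * t) *\<^sub>R g i"
      by (simp add: algebra_simps flip: scaleR_2)
    then show ?thesis
      by (simp add: scaleR_add_right)
  qed
  have "ultra_class I U x = ultra_class I U (?comb t)"
    using eq by (simp add: f(1) g(1) ultra_convex_combination ell)
  then have lim0: "((\<lambda>i. norm (x i - ?comb t i)) \<longlongrightarrow> 0) U"
    by (simp add: ultra_class_eq_iff ell ell_infty_add ell_infty_scale)
  let ?Y = "ultra_class I U ?y" and ?Z = "ultra_class I U ?z"
  have "vdiff ?E (ultra_class I U x) (vscale ?E (1/2) (vadd ?E ?Y ?Z)) =
      ultra_class I U (\<lambda>i. x i - (1/2) *\<^sub>R (?y i + ?z i))"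
    using ell elly ellz by (simp only: vadd_ultrapower vscale_ultrapower vdiff_ultrapower
        ell_infty_add ell_infty_scale)
  then have "((\<lambda>i. norm (x i - ?comb t i)) \<longlongrightarrow>
      vnorm ?E (vdiff ?E (ultra_class I U x) (vscale ?E (1/2) (vadd ?E ?Y ?Z)))) U"
    unfolding mid by (simp add: vnorm_ultrapower[OF U] ell ell_infty_add ell_infty_scale ell_infty_diff)
  with lim0 U have "vnorm ?E (vdiff ?E (ultra_class I U x) (vscale ?E (1/2) (vadd ?E ?Y ?Z))) = 0"
    unfolding ultrafilter_on_def using tendsto_unique by blast
  moreover have "?Y \<in> ultra_set I U C" "?Z \<in> ultra_set I U C"
    using yC zC unfolding ultra_set_def by blast+
  \<comment> \<open>Strong extremality is used for constant sequences, whose midpoint is at distance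
    exactly 0 from the class of \<open>x\<close>.\<close>
  ultimately have "(\<lambda>n::nat. vnorm ?E (vdiff ?E ?Y ?Z)) \<longlonglongrightarrow> 0"
    using str[unfolded strongly_extreme_point_in_def, THEN conjunct2, rule_format,
        of "\<lambda>_. ?Y" "\<lambda>_. ?Z"] by simp
  then have "vnorm ?E (vdiff ?E ?Y ?Z) = 0"
    by (simp add: LIMSEQ_const_iff)
  then have "((\<lambda>i. norm (?y i - ?z i)) \<longlongrightarrow> 0) U"
    using vnorm_ultrapower[OF U ell_infty_diff[OF elly ellz], of X]
    by (simp only: vdiff_ultrapower[OF elly ellz])
  \<comment> \<open>The factor is positive because \<open>0 < t < 1\<close>, so the collapse of the
    shorter segment forces \<open>b = c\<close>.\<close>
  moreover have "norm (?y i - ?z i) = (2 * ?s) * norm (f i - g i)" for i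
  proof -
    have "?y i - ?z i = (2 * ?s) *\<^sub>R (f i - g i)"
      by (simp add: algebra_simps flip: scaleR_2)
    then show ?thesis
      using t by simp
  qed
  ultimately have "((\<lambda>i. (2 * ?s) * norm (f i - g i)) \<longlongrightarrow> 0) U"
    by simp
  then have "((\<lambda>i. norm (f i - g i)) \<longlongrightarrow> 0) U"
    using t by (subst (asm) tendsto_mult_left_iff[where l = 0, simplified]) auto
  then show False
    using \<open>b \<noteq> c\<close> by (simp add: f(1) g(1) ultra_class_eq_iff ell)
qed

section \<open>The uniform condition\<close>

text \<open>Since \<open>d\<close> is chosen before \<open>i\<close>, it is one modulus of strong
  extremality shared by almost all the points \<open>x i\<close>; the finite exceptional set may
  depend on \<open>e\<close>.\<close>

definition asymptotically_strongly_extreme ::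
    "'a::real_normed_vector set \<Rightarrow> 'i set \<Rightarrow> ('i \<Rightarrow> 'a) \<Rightarrow> bool" where
  "asymptotically_strongly_extreme C I x \<longleftrightarrow>
     (\<forall>e>0. \<exists>d>0. \<forall>\<^sub>F i in cofinite_on I. \<forall>y\<in>C. \<forall>z\<in>C.
        norm (x i - (1/2) *\<^sub>R (y + z)) < d \<longrightarrow> norm (y - z) < e)"

lemma asymptotically_strongly_extreme_subset:
  assumes "asymptotically_strongly_extreme C I x" "J \<subseteq> I"
  shows "asymptotically_strongly_extreme C J x"
  using assms(1) filter_leD[OF cofinite_on_mono[OF assms(2)]]
  unfolding asymptotically_strongly_extreme_def by meson

section \<open>Consequences of the uniform condition\<close>

lemma asymptotically_strongly_extreme_tendsto:
  assumes ase: "asymptotically_strongly_extreme C I x"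
    and C: "\<forall>i\<in>I. y i \<in> C" "\<forall>i\<in>I. z i \<in> C"
    and lim: "((\<lambda>i. norm (x i - (1/2) *\<^sub>R (y i + z i))) \<longlongrightarrow> 0) (cofinite_on I)"
  shows "((\<lambda>i. norm (y i - z i)) \<longlongrightarrow> 0) (cofinite_on I)"
proof (rule tendstoI)
  fix e :: real assume "e > 0"
  then obtain d where "d > 0" and ev: "\<forall>\<^sub>F i in cofinite_on I. \<forall>y\<in>C. \<forall>z\<in>C.
      norm (x i - (1/2) *\<^sub>R (y + z)) < d \<longrightarrow> norm (y - z) < e"
    using ase unfolding asymptotically_strongly_extreme_def by blast
  have "\<forall>\<^sub>F i in cofinite_on I. norm (x i - (1/2) *\<^sub>R (y i + z i)) < d"
    using tendstoD[OF lim \<open>d > 0\<close>] by simp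
  moreover have "\<forall>\<^sub>F i in cofinite_on I. i \<in> I"
    by (simp add: eventually_cofinite_on)
  ultimately show "\<forall>\<^sub>F i in cofinite_on I. dist (norm (y i - z i)) 0 < e"
    using ev by eventually_elim (use C in simp)
qed

text \<open>Two limits are involved, along \<open>U\<close> in \<open>i\<close> and along the
  sequences in \<open>n\<close>. The modulus holds for all pairs of points of \<open>C\<close> at
  once, so the same set of indices in \<open>U\<close> serves every \<open>n\<close>.\<close>

lemma asymptotically_strongly_extreme_imp_strongly_extreme:
  assumes ase: "asymptotically_strongly_extreme C I x"
    and "bounded C" "\<forall>i\<in>I. x i \<in> C" and free: "free_ultrafilter_on I U"
  shows "strongly_extreme_point_in (ultrapower X I U) (ultra_set I U C) (ultra_class I U x)"
  unfolding strongly_extreme_point_in_def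
proof (intro conjI allI impI)
  let ?E = "ultrapower X I U"
  have U: "ultrafilter_on I U" and le: "U \<le> cofinite_on I"
    using free by (auto simp: free_ultrafilter_on_iff)
  show "ultra_class I U x \<in> ultra_set I U C"
    using assms(3) by (auto simp: ultra_set_def)
  fix y z :: "nat \<Rightarrow> ('b \<Rightarrow> 'a) set"
  assume y: "\<forall>n. y n \<in> ultra_set I U C" and z: "\<forall>n. z n \<in> ultra_set I U C"
  from y have "\<exists>f. y n = ultra_class I U f \<and> (\<forall>i\<in>I. f i \<in> C)" for n
    by (auto simp: ultra_set_def)
  then obtain f where f: "\<And>n. y n = ultra_class I U (f n)" "\<And>n. \<forall>i\<in>I. f n i \<in> C"
    by metis
  from z have "\<exists>g. z n = ultra_class I U g \<and> (\<forall>i\<in>I. g i \<in> C)" for n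
    by (auto simp: ultra_set_def)
  then obtain g where g: "\<And>n. z n = ultra_class I U (g n)" "\<And>n. \<forall>i\<in>I. g n i \<in> C"
    by metis
  note ell = assms(3)[THEN ell_infty_family[OF \<open>bounded C\<close>]]
    f(2)[THEN ell_infty_family[OF \<open>bounded C\<close>]] g(2)[THEN ell_infty_family[OF \<open>bounded C\<close>]]
  let ?m = "\<lambda>n. vnorm ?E (vdiff ?E (ultra_class I U x) (vscale ?E (1/2) (vadd ?E (y n) (z n))))"
  let ?d = "\<lambda>n. vnorm ?E (vdiff ?E (y n) (z n))"
  have m: "((\<lambda>i. norm (x i - (1/2) *\<^sub>R (f n i + g n i))) \<longlongrightarrow> ?m n) U" for n
    unfolding f(1) g(1) using ell
    by (simp only: vadd_ultrapower vscale_ultrapower vdiff_ultrapower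
        ell_infty_add ell_infty_scale ell_infty_diff vnorm_ultrapower[OF U])
  have d: "((\<lambda>i. norm (f n i - g n i)) \<longlongrightarrow> ?d n) U" for n
    unfolding f(1) g(1) using ell
    by (simp only: vdiff_ultrapower ell_infty_diff vnorm_ultrapower[OF U])
  have ne: "U \<noteq> bot"
    using U by (simp add: ultrafilter_on_def)
  assume lim: "?m \<longlonglongrightarrow> 0"
  show "?d \<longlonglongrightarrow> 0"
  proof (rule tendstoI)
    fix e :: real assume "e > 0"
    \<comment> \<open>Passing to the limit along \<open>U\<close> weakens a strict bound to a weak
      one; \<open>e / 2\<close> leaves room for the final strict inequality.\<close>
    then have "e / 2 > 0" by simp
    then obtain r where "r > 0" and "\<forall>\<^sub>F i in cofinite_on I. \<forall>y\<in>C. \<forall>z\<in>C.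
        norm (x i - (1/2) *\<^sub>R (y + z)) < r \<longrightarrow> norm (y - z) < e / 2"
      using ase unfolding asymptotically_strongly_extreme_def by blast
    then have ev: "\<forall>\<^sub>F i in U. \<forall>y\<in>C. \<forall>z\<in>C.
        norm (x i - (1/2) *\<^sub>R (y + z)) < r \<longrightarrow> norm (y - z) < e / 2"
      using le filter_leD by blast
    have inI: "\<forall>\<^sub>F i in U. i \<in> I"
      using le by (simp add: le_principal)
    have "\<forall>\<^sub>F n in sequentially. ?m n < r"
      using order_tendstoD(2)[OF lim \<open>r > 0\<close>] .
    then show "\<forall>\<^sub>F n in sequentially. dist (?d n) 0 < e"
    proof eventually_elim
      case (elim n)
      have "\<forall>\<^sub>F i in U. norm (x i - (1/2) *\<^sub>R (f n i + g n i)) < r"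
        using order_tendstoD(2)[OF m elim] .
      with ev inI have "\<forall>\<^sub>F i in U. norm (f n i - g n i) \<le> e / 2"
        by eventually_elim (use f(2) g(2) in \<open>simp add: less_imp_le\<close>)
      then have "?d n \<le> e / 2"
        by (rule tendsto_upperbound[OF d _ ne])
      moreover have "0 \<le> ?d n"
        by (rule tendsto_lowerbound[OF d _ ne]) simp
      ultimately show ?case
        using \<open>e > 0\<close> by simp
    qed
  qed
qed

text \<open>The vector \<open>x i - y i\<close> is the midpoint defect minus half of
  \<open>y i - z i\<close>, and both tend to 0. The statement for \<open>z\<close> follows by
  exchanging \<open>y\<close> and \<open>z\<close>.\<close>

lemma asymptotically_strongly_extreme_imp_c0:
  assumes ase: "asymptotically_strongly_extreme C I x" and "bounded C" "\<forall>i\<in>I. x i \<in> C"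
    and yz: "\<forall>i\<in>I. y i \<in> C" "\<forall>i\<in>I. z i \<in> C"
    and mid: "(\<lambda>i. norm (x i - (1/2) *\<^sub>R (y i + z i))) \<in> c0 I"
  shows "(\<lambda>i. norm (x i - y i)) \<in> c0 I"
proof -
  have lim: "((\<lambda>i. norm (x i - (1/2) *\<^sub>R (y i + z i))) \<longlongrightarrow> 0) (cofinite_on I)"
    using mid by (simp add: c0_iff)
  then have "((\<lambda>i. norm (y i - z i)) \<longlongrightarrow> 0) (cofinite_on I)"
    by (rule asymptotically_strongly_extreme_tendsto[OF ase yz])
  with lim have "((\<lambda>i. (x i - (1/2) *\<^sub>R (y i + z i)) - (1/2) *\<^sub>R (y i - z i)) \<longlongrightarrow> 0 - (1/2) *\<^sub>R 0)
      (cofinite_on I)"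
    unfolding tendsto_norm_zero_iff by (intro tendsto_intros)
  moreover have "(x i - (1/2) *\<^sub>R (y i + z i)) - (1/2) *\<^sub>R (y i - z i) = x i - y i" for i
    by (simp add: algebra_simps flip: scaleR_add_left)
  ultimately have "((\<lambda>i. norm (x i - y i)) \<longlongrightarrow> 0) (cofinite_on I)"
    by (simp add: tendsto_norm_zero)
  moreover have "(\<lambda>i. x i - y i) \<in> ell_infty I"
    using assms(3) yz(1) by (intro ell_infty_diff ell_infty_family[OF \<open>bounded C\<close>])
  then have "bounded ((\<lambda>i. norm (x i - y i)) ` I)"
    by (simp add: ell_infty_def bounded_norm_comp)
  ultimately show ?thesis
    by (simp add: c0_iff)
qed

section \<open>Failure of the uniform condition\<close>

text \<open>Recursive choice: \<open>A n\<close> stays nonempty after the finitely many values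
  already chosen are removed.\<close>

lemma infinite_sets_distinct_representatives:
  fixes A :: "nat \<Rightarrow> 'i set"
  assumes "\<And>n. infinite (A n)"
  obtains f where "inj f" "\<And>n. f n \<in> A n"
proof -
  have "\<exists>f. \<forall>n. f n \<in> A n - f ` {..<n}"
  proof (rule dependent_wellorder_choice)
    fix r :: 'i and f g :: "nat \<Rightarrow> 'i" and n
    assume "\<And>k. k < n \<Longrightarrow> f k = g k"
    then have "f ` {..<n} = g ` {..<n}"
      by (intro image_cong) auto
    then show "(r \<in> A n - f ` {..<n}) = (r \<in> A n - g ` {..<n})"
      by simp
  next
    fix n and f :: "nat \<Rightarrow> 'i"
    have "infinite (A n - f ` {..<n})"
      using assms by (simp add: Diff_infinite_finite)
    then show "\<exists>r. r \<in> A n - f ` {..<n}"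
      using infinite_imp_nonempty by blast
  qed
  then obtain f where f: "\<And>n. f n \<in> A n - f ` {..<n}"
    by blast
  have "f m \<noteq> f n" if "m < n" for m n
    using f[of n] that by (metis DiffD2 imageI lessThan_iff)
  then have "inj f"
    by (intro injI) (metis linorder_neqE_nat)
  with that f show thesis
    by blast
qed

text \<open>Packages one counterexample for both uses: against (iii) because \<open>J\<close> is
  infinite, and against extremality along a free ultrafilter on \<open>J\<close>.\<close>

lemma not_asymptotically_strongly_extreme_witness:
  assumes "\<not> asymptotically_strongly_extreme C I x" and "bounded C" "\<forall>i\<in>I. x i \<in> C"
  obtains J y z e where "J \<subseteq> I" "countable J" "infinite J"
    "\<forall>i\<in>I. y i \<in> C" "\<forall>i\<in>I. z i \<in> C"
    "(\<lambda>i. norm (x i - (1/2) *\<^sub>R (y i + z i))) \<in> c0 I"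
    "0 < e" "\<forall>j\<in>J. e \<le> norm (y j - z j)"
proof -
  obtain e where "e > 0" and fail: "\<And>d. d > 0 \<Longrightarrow> \<not> (\<forall>\<^sub>F i in cofinite_on I. \<forall>y\<in>C. \<forall>z\<in>C.
      norm (x i - (1/2) *\<^sub>R (y + z)) < d \<longrightarrow> norm (y - z) < e)"
    using assms(1) unfolding asymptotically_strongly_extreme_def by blast
  \<comment> \<open>The indices at which \<open>inverse (real (Suc n))\<close> fails as a modulus
    for \<open>e\<close>; negating the uniform condition makes each such set infinite.\<close>
  define A where "A n = {i\<in>I. \<not> (\<forall>y\<in>C. \<forall>z\<in>C.
      norm (x i - (1/2) *\<^sub>R (y + z)) < inverse (real (Suc n)) \<longrightarrow> norm (y - z) < e)}" for n
  have "infinite (A n)" for n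
    using fail[of "inverse (real (Suc n))"] by (simp add: eventually_cofinite_on A_def)
  then obtain s where "inj s" and s: "\<And>n. s n \<in> A n"
    using infinite_sets_distinct_representatives by blast
  have "\<exists>y z. y \<in> C \<and> z \<in> C \<and>
      norm (x (s n) - (1/2) *\<^sub>R (y + z)) < inverse (real (Suc n)) \<and> e \<le> norm (y - z)" for n
    using s[of n] unfolding A_def by (fastforce simp: not_less)
  then obtain u v where uv: "\<And>n. u n \<in> C" "\<And>n. v n \<in> C"
      "\<And>n. norm (x (s n) - (1/2) *\<^sub>R (u n + v n)) < inverse (real (Suc n))"
      "\<And>n. e \<le> norm (u n - v n)"
    by metis
  \<comment> \<open>Injectivity of \<open>s\<close> lets \<open>inv s\<close> recover
    \<open>n\<close> from \<open>s n\<close>. Off \<open>range s\<close> the default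
    \<open>x i\<close>, used in \<open>z\<close> as well, makes the midpoint defect vanish.\<close>
  define y where "y i = (if i \<in> range s then u (inv s i) else x i)" for i
  define z where "z i = (if i \<in> range s then v (inv s i) else x i)" for i
  have ys [simp]: "y (s n) = u n" and zs [simp]: "z (s n) = v n" for n
    using \<open>inj s\<close> by (simp_all add: y_def z_def)
  have xx: "norm (x i - (1/2) *\<^sub>R (y i + z i)) = 0" if "i \<notin> range s" for i
    using that by (simp add: y_def z_def flip: scaleR_2)
  have yC: "\<forall>i\<in>I. y i \<in> C" and zC: "\<forall>i\<in>I. z i \<in> C"
    using uv(1,2) assms(3) by (auto simp: y_def z_def)
  have "range s \<subseteq> I"
    using s by (auto simp: A_def)
  moreover have "infinite (range s)"
    using \<open>inj s\<close> by (simp add: finite_image_iff)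
  moreover have "(\<lambda>i. norm (x i - (1/2) *\<^sub>R (y i + z i))) \<in> c0 I"
    unfolding c0_def mem_Collect_eq
  proof (intro conjI allI impI)
    have "(\<lambda>i. x i - (1/2) *\<^sub>R (y i + z i)) \<in> ell_infty I"
      using assms(3) yC zC
      by (intro ell_infty_diff ell_infty_scale ell_infty_add ell_infty_family[OF \<open>bounded C\<close>])
    then show "bounded ((\<lambda>i. norm (x i - (1/2) *\<^sub>R (y i + z i))) ` I)"
      by (simp add: ell_infty_def bounded_norm_comp)
    fix d :: real assume "d > 0"
    then obtain N where N: "inverse (real (Suc N)) < d"
      using reals_Archimedean by blast
    \<comment> \<open>A defect of at least \<open>d\<close> occurs only at some \<open>s n\<close>,
      where it is below 1/(n+1); as \<open>d\<close> exceeds 1/(N+1), this leaves only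
      \<open>n < N\<close>.\<close>
    have "i \<in> s ` {..<N}" if "d \<le> \<bar>norm (x i - (1/2) *\<^sub>R (y i + z i))\<bar>" for i
    proof -
      have "i \<in> range s"
        using xx[of i] that \<open>d > 0\<close> by fastforce
      then obtain n where n: "i = s n"
        by blast
      then have "inverse (real (Suc N)) < inverse (real (Suc n))"
        using that[unfolded abs_norm_cancel n ys zs] uv(3)[of n] N by linarith
      then have "real (Suc n) < real (Suc N)"
        by (rule inverse_less_imp_less) simp
      then have "n < N"
        by simp
      then show ?thesis
        by (simp add: n)
    qed
    then have "{i\<in>I. d \<le> \<bar>norm (x i - (1/2) *\<^sub>R (y i + z i))\<bar>} \<subseteq> s ` {..<N}"
      by blast
    then show "finite {i\<in>I. d \<le> \<bar>norm (x i - (1/2) *\<^sub>R (y i + z i))\<bar>}"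
      by (rule finite_subset) simp
  qed
  ultimately show thesis
    using that[of "range s" y z e] yC zC \<open>e > 0\<close> uv(4) by auto
qed

text \<open>The set \<open>K\<close> lets one argument serve (ii), with \<open>K = I\<close>, and
  (iv), with \<open>K = J\<close>. In both cases \<open>U\<close> lives on \<open>J\<close>, where
  the witnesses stay \<open>e\<close> apart, while extremality would make their distance tend to 0
  along \<open>U\<close>.\<close>

lemma extreme_point_in_subset_imp_asymptotically_strongly_extreme:
  assumes "bounded C" "\<forall>i\<in>I. x i \<in> C"
    and ext: "\<And>J. J \<subseteq> I \<Longrightarrow> countable J \<Longrightarrow> infinite J \<Longrightarrow>
      \<exists>K U. J \<subseteq> K \<and> K \<subseteq> I \<and> free_ultrafilter_on J U \<and>
        extreme_point_in (ultrapower X K U) (ultra_set K U C) (ultra_class K U x)"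
  shows "asymptotically_strongly_extreme C I x"
proof (rule ccontr)
  assume "\<not> ?thesis"
  then obtain J y z e where J: "J \<subseteq> I" "countable J" "infinite J"
    and yz: "\<forall>i\<in>I. y i \<in> C" "\<forall>i\<in>I. z i \<in> C"
      "(\<lambda>i. norm (x i - (1/2) *\<^sub>R (y i + z i))) \<in> c0 I"
    and e: "0 < e" "\<forall>j\<in>J. e \<le> norm (y j - z j)"
    using assms(1,2) by (rule not_asymptotically_strongly_extreme_witness) blast
  from ext[OF J] obtain K U where K: "J \<subseteq> K" "K \<subseteq> I" and U: "free_ultrafilter_on J U"
    and ex: "extreme_point_in (ultrapower X K U) (ultra_set K U C) (ultra_class K U x)"
    by blast
  have "U \<le> cofinite_on I"
    using free_ultrafilter_on_superset[OF U J(1)] by (simp add: free_ultrafilter_on_iff)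
  then have lim: "((\<lambda>i. norm (x i - (1/2) *\<^sub>R (y i + z i))) \<longlongrightarrow> 0) U"
    using yz(3)[unfolded c0_iff, THEN conjunct2] by (rule tendsto_mono)
  have "((\<lambda>i. norm (y i - z i)) \<longlongrightarrow> 0) U"
    by (rule extreme_point_in_tendsto[OF \<open>bounded C\<close> _ _ _ lim ex]) (use assms(2) yz(1,2) K(2) in blast)+
  then have "\<forall>\<^sub>F i in U. norm (y i - z i) < e"
    using e(1) by (rule order_tendstoD)
  moreover have "\<forall>\<^sub>F i in U. i \<in> J"
    using U by (simp add: free_ultrafilter_on_iff le_principal)
  ultimately have "\<forall>\<^sub>F i in U. False"
    by eventually_elim (use e(2) in fastforce)
  with U show False
    by (simp add: free_ultrafilter_on_iff ultrafilter_on_def trivial_limit_def)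
qed

section \<open>Equivalence of the four assertions\<close>

theorem theorem3p9:
  fixes C :: "'a::banach set" and I :: "'i set" and x :: "'i \<Rightarrow> 'a"
  assumes "bounded C" and "convex C" and "infinite I" and "\<forall>i\<in>I. x i \<in> C"
  shows
    "let assertion_i =
           (\<forall>U. free_ultrafilter_on I U \<longrightarrow>
              strongly_extreme_point_in (ultrapower TYPE('a) I U)
                (ultra_set I U C) (ultra_class I U x));
         assertion_ii =
           (\<forall>U. free_ultrafilter_on I U \<longrightarrow>
              extreme_point_in (ultrapower TYPE('a) I U)
                (ultra_set I U C) (ultra_class I U x));
         assertion_iii =
           (\<forall>y z. (\<forall>i\<in>I. y i \<in> C) \<longrightarrow> (\<forall>i\<in>I. z i \<in> C) \<longrightarrow>
              (\<lambda>i. norm (x i - (1/2) *\<^sub>R (y i + z i))) \<in> c0 I \<longrightarrow>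
              (\<lambda>i. norm (x i - y i)) \<in> c0 I \<and> (\<lambda>i. norm (x i - z i)) \<in> c0 I);
         assertion_iv =
           (\<forall>J V. J \<subseteq> I \<longrightarrow> countable J \<longrightarrow> free_ultrafilter_on J V \<longrightarrow>
              extreme_point_in (ultrapower TYPE('a) J V)
                (ultra_set J V C) (ultra_class J V x))
     in (assertion_i \<longleftrightarrow> assertion_ii) \<and>
        (assertion_ii \<longleftrightarrow> assertion_iii) \<and>
        (assertion_iii \<longleftrightarrow> assertion_iv)"
proof -
  note ase_strong = asymptotically_strongly_extreme_imp_strongly_extreme
    [OF _ \<open>bounded C\<close>, where X = "TYPE('a)"]
  note strong_ext = strongly_extreme_imp_extreme
    [OF \<open>bounded C\<close> \<open>convex C\<close>, where X = "TYPE('a)"]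
  note ext_ase = extreme_point_in_subset_imp_asymptotically_strongly_extreme
    [OF \<open>bounded C\<close> assms(4), where X = "TYPE('a)"]
  let ?ase = "asymptotically_strongly_extreme C I x"
  let ?i = "\<forall>U. free_ultrafilter_on I U \<longrightarrow>
    strongly_extreme_point_in (ultrapower TYPE('a) I U) (ultra_set I U C) (ultra_class I U x)"
  let ?ii = "\<forall>U. free_ultrafilter_on I U \<longrightarrow>
    extreme_point_in (ultrapower TYPE('a) I U) (ultra_set I U C) (ultra_class I U x)"
  let ?iii = "\<forall>y z. (\<forall>i\<in>I. y i \<in> C) \<longrightarrow> (\<forall>i\<in>I. z i \<in> C) \<longrightarrow>
    (\<lambda>i. norm (x i - (1/2) *\<^sub>R (y i + z i))) \<in> c0 I \<longrightarrow>
    (\<lambda>i. norm (x i - y i)) \<in> c0 I \<and> (\<lambda>i. norm (x i - z i)) \<in> c0 I"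
  let ?iv = "\<forall>J V. J \<subseteq> I \<longrightarrow> countable J \<longrightarrow> free_ultrafilter_on J V \<longrightarrow>
    extreme_point_in (ultrapower TYPE('a) J V) (ultra_set J V C) (ultra_class J V x)"
  have i: "?ase \<Longrightarrow> ?i"
    using ase_strong assms(4) by blast
  have ii: "?i \<Longrightarrow> ?ii"
    using strong_ext[OF assms(4)] by (simp add: free_ultrafilter_on_iff)
  have ii_ase: ?ase if ?ii
  proof (rule ext_ase)
    fix J assume J: "J \<subseteq> I" "infinite J"
    then obtain U where U: "free_ultrafilter_on J U"
      using free_ultrafilter_on_exists by blast
    with that free_ultrafilter_on_superset[OF U J(1)] J(1)
    show "\<exists>K U. J \<subseteq> K \<and> K \<subseteq> I \<and> free_ultrafilter_on J U \<and>
        extreme_point_in (ultrapower TYPE('a) K U) (ultra_set K U C) (ultra_class K U x)"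
      by blast
  qed
  have iv: ?iv if ?ase
  proof (intro allI impI)
    fix J V assume J: "J \<subseteq> I" and V: "free_ultrafilter_on J V"
    then have xC: "\<forall>j\<in>J. x j \<in> C"
      using assms(4) by blast
    have "strongly_extreme_point_in (ultrapower TYPE('a) J V) (ultra_set J V C) (ultra_class J V x)"
      using ase_strong[OF asymptotically_strongly_extreme_subset[OF that J] xC V] .
    then show "extreme_point_in (ultrapower TYPE('a) J V) (ultra_set J V C) (ultra_class J V x)"
      using strong_ext[OF xC] V by (simp add: free_ultrafilter_on_iff)
  qed
  have iv_ase: ?ase if ?iv
  proof (rule ext_ase)
    fix J assume J: "J \<subseteq> I" "countable J" "infinite J"
    then obtain U where U: "free_ultrafilter_on J U"
      using free_ultrafilter_on_exists by blast
    with that J show "\<exists>K U. J \<subseteq> K \<and> K \<subseteq> I \<and> free_ultrafilter_on J U \<and>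
        extreme_point_in (ultrapower TYPE('a) K U) (ultra_set K U C) (ultra_class K U x)"
      by blast
  qed
  have iii: ?iii if ?ase
  proof (intro allI impI)
    fix y z assume yz: "\<forall>i\<in>I. y i \<in> C" "\<forall>i\<in>I. z i \<in> C"
      and mid: "(\<lambda>i. norm (x i - (1/2) *\<^sub>R (y i + z i))) \<in> c0 I"
    note c0 = asymptotically_strongly_extreme_imp_c0[OF that \<open>bounded C\<close> assms(4)]
    show "(\<lambda>i. norm (x i - y i)) \<in> c0 I \<and> (\<lambda>i. norm (x i - z i)) \<in> c0 I"
      using c0[OF yz mid] c0[OF yz(2,1)] mid by (simp add: add.commute)
  qed
  have iii_ase: ?ase if ?iii
  proof (rule ccontr)
    assume "\<not> ?ase"
    then obtain J y z e where J: "J \<subseteq> I" "infinite J"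
      and yz: "\<forall>i\<in>I. y i \<in> C" "\<forall>i\<in>I. z i \<in> C"
        "(\<lambda>i. norm (x i - (1/2) *\<^sub>R (y i + z i))) \<in> c0 I"
      and e: "0 < e" "\<forall>j\<in>J. e \<le> norm (y j - z j)"
      using assms(1,4) by (rule not_asymptotically_strongly_extreme_witness) blast
    with that have "(\<lambda>i. norm (x i - y i)) \<in> c0 I" "(\<lambda>i. norm (x i - z i)) \<in> c0 I"
      by blast+
    then have fin: "finite ({i\<in>I. \<bar>norm (x i - y i)\<bar> \<ge> e / 2} \<union> {i\<in>I. \<bar>norm (x i - z i)\<bar> \<ge> e / 2})"
      unfolding c0_def finite_Un mem_Collect_eq by (meson half_gt_zero[OF e(1)])
    \<comment> \<open>Points at distance at least \<open>e\<close> cannot both be within less than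
      \<open>e / 2\<close> of \<open>x j\<close>; thus the infinite set \<open>J\<close> is covered
      by two finite sets.\<close>
    have "\<bar>norm (x j - y j)\<bar> \<ge> e / 2 \<or> \<bar>norm (x j - z j)\<bar> \<ge> e / 2" if "j \<in> J" for j
      using e(2) that norm_triangle_ineq4[of "x j - z j" "x j - y j"] by fastforce
    then have "J \<subseteq> {i\<in>I. \<bar>norm (x i - y i)\<bar> \<ge> e / 2} \<union> {i\<in>I. \<bar>norm (x i - z i)\<bar> \<ge> e / 2}"
      using J(1) by blast
    with fin J(2) show False
      using finite_subset by blast
  qed
  \<comment> \<open>The implications form a cycle from \<open>?ase\<close> through \<open>?i\<close>
    and \<open>?ii\<close> back to \<open>?ase\<close>, together with equivalences of
    \<open>?ase\<close> with \<open>?iii\<close> and with \<open>?iv\<close>.\<close>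
  have "(?i \<longleftrightarrow> ?ii) \<and> (?ii \<longleftrightarrow> ?iii) \<and> (?iii \<longleftrightarrow> ?iv)"
    using i ii ii_ase iii iii_ase iv iv_ase by argo
  then show ?thesis
    by (simp only: Let_def)
qed

end
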